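(* Let $n$ and $a_{\ell+1}$ be positive integers and let $a_0,a_j,b_j\in\mathbb{N}_0$, $c_j\in\mathbb{N}$ with $c_j\ge3$ for $1\le j\le\ell$. Then $H_n^\star[\mathbf{s}]=-\sum_{(\mathbf{p};\tilde{\mathbf{p}};\tilde{\tilde{\mathbf{p}}})\in\Pi(\mathbf{s})}\mathcal{H}_n[\mathbf{p};\tilde{\mathbf{p}};\tilde{\tilde{\mathbf{p}}}]$ in each of the following two cases. (A) $\ell\in\mathbb{N}$, $\mathbf{s}=(\{2\}^{b_1},c_1,\{2\}^{a_1},1,\dots,\{2\}^{b_\ell},c_\ell,\{2\}^{a_\ell},1,\{2\}^{a_{\ell+1}})$, and $\Pi(\mathbf{s})=\{\overline{2b_1+2}\circ1^{\circ(c_1-3)}\circ\overline{2a_1+2}\circ\cdots\circ\overline{2b_\ell+2}\circ1^{\circ(c_\ell-3)}\circ\overline{2a_\ell+2}\circ\overline{2a_{\ell+1}};\ (b_1+1)\circ0^{\circ(c_1-3)}\circ(a_1+1)\circ\cdots\circ(b_\ell+1)\circ0^{\circ(c_\ell-3)}\circ(a_\ell+1)\circ a_{\ell+1};\ 1\circ\theta^{\circ(c_1-3)}\circ1\circ\big((-1)\circ\theta^{\circ(c_2-3)}\circ1\big)\circ\cdots\circ\big((-1)\circ\theta^{\circ(c_\ell-3)}\circ1\big)\circ(-1)\}$, i.e. the third string is $1,\theta^{c_1-3},1$, followed for each $j=2,\dots,\ell$ by the block $-1,\theta^{c_j-3},1$, followed by a final $-1$. (B) $\ell\in\mathbb{N}_0$,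 $\mathbf{s}=(\{2\}^{a_0},1,\{2\}^{b_1},c_1,\{2\}^{a_1},1,\dots,\{2\}^{b_\ell},c_\ell,\{2\}^{a_\ell},1,\{2\}^{a_{\ell+1}})$, and $\Pi(\mathbf{s})=\{(2a_0+1)\circ\overline{2b_1+2}\circ1^{\circ(c_1-3)}\circ\overline{2a_1+2}\circ\cdots\circ\overline{2b_\ell+2}\circ1^{\circ(c_\ell-3)}\circ\overline{2a_\ell+2}\circ\overline{2a_{\ell+1}};\ (a_0+1)\circ(b_1+1)\circ0^{\circ(c_1-3)}\circ(a_1+1)\circ\cdots\circ(b_\ell+1)\circ0^{\circ(c_\ell-3)}\circ(a_\ell+1)\circ a_{\ell+1};\ 2\circ\big((-1)\circ\theta^{\circ(c_1-3)}\circ1\big)\circ\cdots\circ\big((-1)\circ\theta^{\circ(c_\ell-3)}\circ1\big)\circ(-1)\}$, i.e. the third string is $2$, followed for each $j=1,\dots,\ell$ by the block $-1,\theta^{c_j-3},1$, followed by a final $-1$.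
   Context: Fix $0<q<1$. $[k]=(1-q^k)/(1-q)$; $(x;q)_n=\prod_{i=0}^{n-1}(1-xq^i)$; $\binom{n}{k}_q=(q;q)_n/((q;q)_k(q;q)_{n-k})$ for $0\le k\le n$, else $0$. $\{x\}^a$ denotes $a$ copies of $x$. Signed numbers: $\mathbb{D}_0=\mathbb{N}_0\cup\{\bar k:k\in\mathbb{N}_0\}$ ($\bar k$ a formal symbol), $|k|=|\bar k|=k$, $\operatorname{sgn}(k)=1$, $\operatorname{sgn}(\bar k)=-1$; $a\oplus b=\overline{|a|+|b|}$ if exactly one of $a,b$ is unbarred, $a+b$ if both unbarred, $|a|+|b|$ if both barred. For $\mathbf{s}\in\mathbb{D}_0^m$: $H_n^\star[\mathbf{s}]=\sum_{n\ge k_1\ge\cdots\ge k_m\ge1}\prod_{j}\operatorname{sgn}(s_j)^{k_j}q^{k_j}/[k_j]^{|s_j|}$. $\theta$ is a formal symbol; $Q(r,k)=rk(k-1)/2$ if $r\in\mathbb{Z},r>0$; $Q(r,k)=rk(k-1)/2-k$ if $r\in\mathbb{Z},r\le0$; $Q(\theta,k)=0$. On $\mathbb{Z}\cup\{\theta\}$: $\theta\boxplus a=a\boxplus\theta=a$; $a\boxplus b=a+b$ for integers with $(a,b)\neq(1,-1),(-1,1)$; $1\boxplus(-1)=\theta$, $(-1)\boxplus1=0$; iterated $\boxplus$ evaluated left to right. For $\mathbf{s}\in\mathbb{D}_0^m$, $\mathbf{t}\in\mathbb{N}_0^m$, $\mathbf{r}\in(\mathbb{Z}\cup\{\theta\})^m$,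 $m\ge1$: $$\mathcal{H}_n[\mathbf{s};\mathbf{t};\mathbf{r}]=\sum_{n\ge k_1>\cdots>k_m\ge1}\frac{\binom{n}{k_1}_q}{\binom{n+k_1}{k_1}_q}\prod_{j=1}^m\frac{\operatorname{sgn}(s_j)^{k_j}q^{t_jk_j+Q(r_j,k_j)}(1+q^{k_j})}{[k_j]^{|s_j|}}.$$ Merging notation: the set $\{x_1\circ\cdots\circ x_N;y_1\circ\cdots\circ y_N;z_1\circ\cdots\circ z_N\}$ consists of the triples obtained from all $2^{N-1}$ choices, for each of the $N-1$ gaps, of a comma or a merge (same choice in all three strings); each maximal run of merged entries becomes one entry: its $\oplus$-sum in the first string, ordinary sum in the second, $\boxplus$-combination in the third; sums over such a set run over all $2^{N-1}$ choices. $x^{\circ k}$ means $k$ copies of $x$ separated by $\circ$ (empty if $k=0$, with the adjoining $\circ$ dropped). *)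

theory Defs
  imports Complex_Main "HOL-Library.Multiset"
begin

definition q_num :: "real \<Rightarrow> nat \<Rightarrow> real" where
  "q_num q k = (1 - q ^ k) / (1 - q)"

definition q_poch :: "real \<Rightarrow> real \<Rightarrow> nat \<Rightarrow> real" where
  "q_poch x q n = (\<Prod>i<n. 1 - x * q ^ i)"

definition q_binom :: "real \<Rightarrow> nat \<Rightarrow> nat \<Rightarrow> real" where
  "q_binom q n k =
     (if k \<le> n then q_poch q q n / (q_poch q q k * q_poch q q (n - k)) else 0)"

datatype snum = Plain nat | Barred nat

fun snum_abs :: "snum \<Rightarrow> nat" where
  "snum_abs (Plain k) = k"
| "snum_abs (Barred k) = k"

fun snum_sgn :: "snum \<Rightarrow> real" where
  "snum_sgn (Plain k) = 1"
| "snum_sgn (Barred k) = -1"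

fun snum_plus :: "snum \<Rightarrow> snum \<Rightarrow> snum" where
  "snum_plus (Plain a) (Plain b) = Plain (a + b)"
| "snum_plus (Plain a) (Barred b) = Barred (a + b)"
| "snum_plus (Barred a) (Plain b) = Barred (a + b)"
| "snum_plus (Barred a) (Barred b) = Plain (a + b)"

definition H_star :: "real \<Rightarrow> nat \<Rightarrow> snum list \<Rightarrow> real" where
  "H_star q n s =
     (\<Sum>k | length k = length s \<and> set k \<subseteq> {1..n} \<and> sorted_wrt (\<ge>) k.
        \<Prod>j<length s. snum_sgn (s ! j) ^ (k ! j) * q ^ (k ! j) / q_num q (k ! j) ^ snum_abs (s ! j))"

datatype zth = Z int | Theta

text \<open>Both divisions by 2 in \<open>Q_exp\<close> are exact.\<close>

fun Q_exp :: "zth \<Rightarrow> nat \<Rightarrow> int" where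
  "Q_exp (Z r) k = (if r > 0 then r * (int k * (int k - 1)) div 2
                    else r * (int k * (int k - 1)) div 2 - int k)"
| "Q_exp Theta k = 0"

text \<open>This operation is neither commutative nor associative: combining \<open>1\<close> with \<open>-1\<close> gives
  \<open>\<theta>\<close>, whereas combining \<open>-1\<close> with \<open>1\<close> gives the integer \<open>0\<close>.\<close>

fun zth_plus :: "zth \<Rightarrow> zth \<Rightarrow> zth" where
  "zth_plus Theta y = y"
| "zth_plus (Z x) Theta = Z x"
| "zth_plus (Z x) (Z y) = (if x = 1 \<and> y = -1 then Theta else Z (x + y))"

text \<open>Meaningful for nonempty lists \<open>s\<close>, \<open>t\<close>, \<open>r\<close> of equal length. Indices start at 0,
  so \<open>k ! 0\<close> is the largest summation index. The exponent of \<open>q\<close> can be negative.\<close>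

definition H_cal :: "real \<Rightarrow> nat \<Rightarrow> snum list \<Rightarrow> nat list \<Rightarrow> zth list \<Rightarrow> real" where
  "H_cal q n s t r =
     (\<Sum>k | length k = length s \<and> set k \<subseteq> {1..n} \<and> sorted_wrt (>) k.
        q_binom q n (k ! 0) / q_binom q (n + k ! 0) (k ! 0) *
        (\<Prod>j<length s. snum_sgn (s ! j) ^ (k ! j)
           * q powi (int (t ! j) * int (k ! j) + Q_exp (r ! j) (k ! j))
           * (1 + q ^ (k ! j)) / q_num q (k ! j) ^ snum_abs (s ! j)))"

text \<open>\<open>merge_runs f xs cs\<close> reads \<open>cs ! i\<close> as the choice made in the \<open>i\<close>-th gap of \<open>xs\<close>
  (\<open>True\<close>: merge, \<open>False\<close>: comma) and combines each run of merged entries by \<open>f\<close>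
  from left to right.\<close>

fun merge_runs :: "('a \<Rightarrow> 'a \<Rightarrow> 'a) \<Rightarrow> 'a list \<Rightarrow> bool list \<Rightarrow> 'a list" where
  "merge_runs f (x # y # ys) (c # cs) =
     (if c then merge_runs f (f x y # ys) cs else x # merge_runs f (y # ys) cs)"
| "merge_runs f xs cs = xs"

text \<open>A multiset, so that each of the \<open>2\<^bsup>N-1\<^esup>\<close> choices contributes one triple.\<close>

definition merged ::
    "snum list \<Rightarrow> nat list \<Rightarrow> zth list \<Rightarrow> (snum list \<times> nat list \<times> zth list) multiset" where
  "merged xs ys zs =
     image_mset (\<lambda>cs. (merge_runs snum_plus xs cs, merge_runs (+) ys cs, merge_runs zth_plus zs cs))
       (mset_set {cs. length cs = length xs - 1})"

text \<open>The parts indexed by \<open>j = 1, \<dots>, l\<close>, and the entry with index \<open>l + 1\<close>, are common to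
  both families of arguments; \<open>a 0\<close> only enters the second family.\<close>

definition s_tail :: "nat \<Rightarrow> (nat \<Rightarrow> nat) \<Rightarrow> (nat \<Rightarrow> nat) \<Rightarrow> (nat \<Rightarrow> nat) \<Rightarrow> snum list" where
  "s_tail l a b c =
     concat (map (\<lambda>j. replicate (b j) (Plain 2) @ [Plain (c j)] @ replicate (a j) (Plain 2) @ [Plain 1])
       [1..<l + 1])
     @ replicate (a (l + 1)) (Plain 2)"

definition p1_tail :: "nat \<Rightarrow> (nat \<Rightarrow> nat) \<Rightarrow> (nat \<Rightarrow> nat) \<Rightarrow> (nat \<Rightarrow> nat) \<Rightarrow> snum list" where
  "p1_tail l a b c =
     concat (map (\<lambda>j. [Barred (2 * b j + 2)] @ replicate (c j - 3) (Plain 1) @ [Barred (2 * a j + 2)])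
       [1..<l + 1])
     @ [Barred (2 * a (l + 1))]"

definition p2_tail :: "nat \<Rightarrow> (nat \<Rightarrow> nat) \<Rightarrow> (nat \<Rightarrow> nat) \<Rightarrow> (nat \<Rightarrow> nat) \<Rightarrow> nat list" where
  "p2_tail l a b c =
     concat (map (\<lambda>j. [b j + 1] @ replicate (c j - 3) 0 @ [a j + 1]) [1..<l + 1])
     @ [a (l + 1)]"

definition p3_tail :: "nat \<Rightarrow> nat \<Rightarrow> (nat \<Rightarrow> nat) \<Rightarrow> zth list" where
  "p3_tail i l c =
     concat (map (\<lambda>j. [Z (-1)] @ replicate (c j - 3) Theta @ [Z 1]) [i..<l + 1]) @ [Z (-1)]"

definition s_A :: "nat \<Rightarrow> (nat \<Rightarrow> nat) \<Rightarrow> (nat \<Rightarrow> nat) \<Rightarrow> (nat \<Rightarrow> nat) \<Rightarrow> snum list" where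
  "s_A l a b c = s_tail l a b c"

definition Pi_A :: "nat \<Rightarrow> (nat \<Rightarrow> nat) \<Rightarrow> (nat \<Rightarrow> nat) \<Rightarrow> (nat \<Rightarrow> nat)
    \<Rightarrow> (snum list \<times> nat list \<times> zth list) multiset" where
  "Pi_A l a b c =
     merged (p1_tail l a b c) (p2_tail l a b c)
       ([Z 1] @ replicate (c 1 - 3) Theta @ [Z 1] @ p3_tail 2 l c)"

definition s_B :: "nat \<Rightarrow> (nat \<Rightarrow> nat) \<Rightarrow> (nat \<Rightarrow> nat) \<Rightarrow> (nat \<Rightarrow> nat) \<Rightarrow> snum list" where
  "s_B l a b c = replicate (a 0) (Plain 2) @ [Plain 1] @ s_tail l a b c"

definition Pi_B :: "nat \<Rightarrow> (nat \<Rightarrow> nat) \<Rightarrow> (nat \<Rightarrow> nat) \<Rightarrow> (nat \<Rightarrow> nat)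
    \<Rightarrow> (snum list \<times> nat list \<times> zth list) multiset" where
  "Pi_B l a b c =
     merged ([Plain (2 * a 0 + 1)] @ p1_tail l a b c) ([a 0 + 1] @ p2_tail l a b c)
       ([Z 2] @ p3_tail 1 l c)"

end

theory Submission
  imports Defs
begin

text \<open>Let \<open>B n k\<close> be the quotient of \<open>q\<close>-binomials in the definition of \<open>H_cal\<close>, and write functions of \<open>n\<close>
  as \<open>f n = (\<Sum>k=1..n. B n k * w k)\<close>. Prepending an entry \<open>2\<close> to the argument of \<open>H_star\<close> multiplies
  \<open>w k\<close> by \<open>q^k / [k]^2\<close>. Multiplying or dividing \<open>f n\<close> by \<open>[n]\<close> replaces \<open>w k\<close> by a combination of \<open>w k\<close>
  and a sum over \<open>j < k\<close>, because two sums over \<open>k > j\<close> of multiples of \<open>B n k\<close> telescope. Prepending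
  \<open>1\<close> or \<open>c \<ge> 3\<close> is a composition of these operations. The two terms of each combination are
  the choices \<open>merge\<close> and \<open>comma\<close> in front of the remaining entries, so the coefficients of
  \<open>H_star\<close> are the sums over all merge choices. The constant function \<open>1\<close> starts the recursion: its
  coefficients are given by the first telescoping sum at \<open>j = 0\<close>.\<close>

section \<open>Exponents of \<open>q\<close> under merging\<close>

fun Q_lin :: "zth \<Rightarrow> nat \<Rightarrow> int" where
  "Q_lin (Z r) k = r * int (k choose 2)"
| "Q_lin Theta k = 0"

lemma choose_two_int: "r * (int k * (int k - 1)) div 2 = r * int (k choose 2)"
proof -
  have "int k * (int k - 1) = 2 * int (k choose 2)"
  proof (induction k)
    case (Suc k)
    then show ?case by (simp add: numeral_2_eq_2 algebra_simps)
  qed simp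
  then show ?thesis by simp
qed

lemma Q_exp_eq:
  "Q_exp (Z r) k = (if r > 0 then r * int (k choose 2) else r * int (k choose 2) - int k)"
  by (simp add: choose_two_int)

declare Q_exp.simps(1) [simp del]

text \<open>The correction \<open>- k\<close> in \<open>Q_exp\<close> is determined by the first entry of a merged run: every further
  entry contributes its linear part \<open>Q_lin\<close>, in all runs that start at \<open>x\<close> or inside the list.\<close>

fun box_linear :: "zth \<Rightarrow> zth list \<Rightarrow> bool" where
  "box_linear x [] \<longleftrightarrow> True"
| "box_linear x (y # ys) \<longleftrightarrow>
     (\<forall>k. Q_exp (zth_plus x y) k = Q_exp x k + Q_lin y k)
     \<and> box_linear (zth_plus x y) ys \<and> box_linear y ys"

text \<open>Merging \<open>Theta\<close> changes none of the three admissible values of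
  \<open>x\<close>, and the closing \<open>Z 1\<close> turns -1, \<theta>, 1 into 0, 1, 2. Runs
  opening inside the list begin with \<open>Theta\<close> or \<open>Z 1\<close> and fall under the
  same cases.\<close>

lemma box_linear_thetas:
  assumes "x \<in> {Z 1, Theta, Z (-1)}"
    and "\<And>x. x \<in> {Z 0, Z 1, Z 2} \<Longrightarrow> box_linear x zs"
  shows "box_linear x (replicate m Theta @ Z 1 # zs)"
  using assms(1)
proof (induction m arbitrary: x)
  case 0
  then show ?case by (auto simp: Q_exp_eq assms(2))
next
  case (Suc m)
  from Suc.prems show ?case by (auto simp: Q_exp_eq Suc.IH)
qed

lemma p3_tail_Cons:
  "i \<le> l \<Longrightarrow> p3_tail i l c = Z (-1) # replicate (c i - 3) Theta @ Z 1 # p3_tail (Suc i) l c"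
  unfolding p3_tail_def by (simp add: upt_conv_Cons del: upt_Suc)

text \<open>Combining 0, 1, 2 with -1 gives -1, \<theta>, 1, exactly the values that
  \<open>box_linear_thetas\<close> accepts, so the invariant passes from block to block. For 1 with
  -1 the result must be \<open>Theta\<close>: \<open>Z 0\<close> would carry a correction -k that is
  absent from \<open>Q_exp (Z 1)\<close>.\<close>

lemma box_linear_p3_tail:
  assumes "i \<le> Suc l" "x \<in> {Z 0, Z 1, Z 2}"
  shows "box_linear x (p3_tail i l c)"
  using assms
proof (induction i arbitrary: x rule: inc_induct)
  case base
  then show ?case by (auto simp: p3_tail_def Q_exp_eq)
next
  case (step i)
  have *: "box_linear y (replicate (c i - 3) Theta @ Z 1 # p3_tail (Suc i) l c)"
    if "y \<in> {Z 1, Theta, Z (-1)}" for y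
    using that step.IH by (rule box_linear_thetas)
  have "i \<le> l" using step.hyps by simp
  show ?case unfolding p3_tail_Cons[OF \<open>i \<le> l\<close>]
    using step.prems by (auto simp: Q_exp_eq *)
qed

section \<open>Splitting off the largest summation index\<close>

lemma sorted_lists_Cons:
  fixes R :: "nat \<Rightarrow> nat \<Rightarrow> bool"
  assumes "\<And>k. k \<in> {1..n} \<Longrightarrow> {x \<in> {1..n}. R k x} = {1..u k}"
  shows "{ks. length ks = Suc m \<and> set ks \<subseteq> {1..n} \<and> sorted_wrt R ks} =
    (\<lambda>(k, ks). k # ks) ` (SIGMA k : {1..n}. {ks. length ks = m \<and> set ks \<subseteq> {1..u k} \<and> sorted_wrt R ks})"
    (is "?L = ?R")
proof (intro set_eqI iffI)
  fix ks assume "ks \<in> ?L"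
  then obtain k ks' where ks: "ks = k # ks'" "length ks' = m" "k \<in> {1..n}" "set ks' \<subseteq> {1..n}"
    "\<forall>x\<in>set ks'. R k x" "sorted_wrt R ks'" by (cases ks) auto
  then have "set ks' \<subseteq> {1..u k}" using assms[of k] by blast
  then show "ks \<in> ?R" using ks by force
next
  fix ks assume "ks \<in> ?R"
  then obtain k ks' where ks: "ks = k # ks'" "length ks' = m" "k \<in> {1..n}" "set ks' \<subseteq> {1..u k}"
    "sorted_wrt R ks'" by auto
  then show "ks \<in> ?L" using assms[of k] by force
qed

text \<open>Serves both kinds of nested sums: \<open>u k = k\<close> for weakly decreasing indices,
  \<open>u k = k - 1\<close> for strictly decreasing ones.\<close>

lemma sum_sorted_lists_Cons:
  fixes R :: "nat \<Rightarrow> nat \<Rightarrow> bool" and G :: "nat list \<Rightarrow> real"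
  assumes "\<And>k. k \<in> {1..n} \<Longrightarrow> {x \<in> {1..n}. R k x} = {1..u k}"
  shows "(\<Sum>ks | length ks = Suc m \<and> set ks \<subseteq> {1..n} \<and> sorted_wrt R ks. G ks) =
    (\<Sum>k\<in>{1..n}. \<Sum>ks | length ks = m \<and> set ks \<subseteq> {1..u k} \<and> sorted_wrt R ks. G (k # ks))"
proof -
  have fin: "finite {ks. length ks = m \<and> set ks \<subseteq> {1..N} \<and> sorted_wrt R ks}" for N :: nat
    by (rule finite_subset[OF _ finite_lists_length_eq[of "{1..N}" m]]) auto
  have inj: "inj_on (\<lambda>(k, ks). k # ks) A" for A :: "(nat \<times> nat list) set"
    by (auto simp: inj_on_def)
  show ?thesis
    by (subst sorted_lists_Cons[where R = R and u = u, OF assms], assumption,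
        subst sum.reindex[OF inj], subst sum.Sigma)
       (use fin in \<open>simp_all add: comp_def case_prod_unfold\<close>)
qed

lemma H_star_Nil: "H_star q n [] = 1"
proof -
  have "{k :: nat list. length k = length ([] :: snum list) \<and> set k \<subseteq> {1..n} \<and> sorted_wrt (\<ge>) k} = {[]}"
    by auto
  then show ?thesis unfolding H_star_def by simp
qed

lemma H_star_Cons:
  "H_star q n (s # ss) =
     (\<Sum>k=1..n. snum_sgn s ^ k * q ^ k / q_num q k ^ snum_abs s * H_star q k ss)"
proof -
  have "{x \<in> {1..n}. k \<ge> x} = {1..k}" if "k \<in> {1..n}" for k :: nat
    using that by auto
  note * = sum_sorted_lists_Cons[of n "(\<ge>)" "\<lambda>k. k", OF this]
  show ?thesis unfolding H_star_def
    by (simp only: list.size add_Suc_right add_0_right)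
       (subst *, simp_all del: prod.lessThan_Suc add: prod.lessThan_Suc_shift sum_distrib_left)
qed

text \<open>The binomial quotient becomes an arbitrary factor \<open>F\<close>, because the inner
  sums left after splitting off the largest index have the same shape with
  \<open>F = 1\<close>.\<close>

definition H_strict ::
  "(nat \<Rightarrow> real) \<Rightarrow> real \<Rightarrow> nat \<Rightarrow> snum list \<Rightarrow> nat list \<Rightarrow> zth list \<Rightarrow> real" where
  "H_strict F q n s t r =
     (\<Sum>k | length k = length s \<and> set k \<subseteq> {1..n} \<and> sorted_wrt (>) k.
        F (k ! 0) * (\<Prod>j<length s. snum_sgn (s ! j) ^ (k ! j)
           * q powi (int (t ! j) * int (k ! j) + Q_exp (r ! j) (k ! j))
           * (1 + q ^ (k ! j)) / q_num q (k ! j) ^ snum_abs (s ! j)))"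

lemma H_cal_eq_H_strict:
  "H_cal q n = H_strict (\<lambda>k. q_binom q n k / q_binom q (n + k) k) q n"
  by (intro ext) (simp add: H_cal_def H_strict_def)

text \<open>The factor \<open>1 + q^k\<close> and the correction in \<open>Q_exp\<close> occur once
  per run. Hence an entry that opens a run has this weight, and an entry appended to a run has
  \<open>merge_weight\<close>.\<close>

fun lead_weight :: "real \<Rightarrow> snum \<times> nat \<times> zth \<Rightarrow> nat \<Rightarrow> real" where
  "lead_weight q (s, t, r) k =
     snum_sgn s ^ k * q powi (int t * int k + Q_exp r k) * (1 + q ^ k) / q_num q k ^ snum_abs s"

fun merge_weight :: "real \<Rightarrow> snum \<times> nat \<times> zth \<Rightarrow> nat \<Rightarrow> real" where
  "merge_weight q (s, t, r) k =
     snum_sgn s ^ k * q powi (int t * int k + Q_lin r k) / q_num q k ^ snum_abs s"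

lemma H_strict_Nil: "H_strict (\<lambda>_. 1) q n [] [] [] = 1"
proof -
  have "{k :: nat list. length k = length ([] :: snum list) \<and> set k \<subseteq> {1..n} \<and> sorted_wrt (>) k} = {[]}"
    by auto
  then show ?thesis unfolding H_strict_def by simp
qed

lemma H_strict_Cons:
  "H_strict F q n (s # ss) (t # ts) (r # rs) =
     (\<Sum>k=1..n. F k * lead_weight q (s, t, r) k * H_strict (\<lambda>_. 1) q (k - 1) ss ts rs)"
proof -
  have "{x \<in> {1..n}. k > x} = {1..k-1}" if "k \<in> {1..n}" for k :: nat
    using that by auto
  note * = sum_sorted_lists_Cons[of n "(>)" "\<lambda>k. k - 1", OF this]
  show ?thesis unfolding H_strict_def
    by (simp only: list.size add_Suc_right add_0_right)
       (subst *, simp_all del: prod.lessThan_Suc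
          add: prod.lessThan_Suc_shift sum_distrib_left mult.assoc)
qed

text \<open>The total contribution of all merge choices for the entries following a run with index
  \<open>k\<close>: the first summand merges \<open>y\<close> into that run, the second puts a comma
  and opens a new run at a smaller index \<open>j\<close>.\<close>

fun merge_factor :: "real \<Rightarrow> (snum \<times> nat \<times> zth) list \<Rightarrow> nat \<Rightarrow> real" where
  "merge_factor q [] k = 1"
| "merge_factor q (y # ys) k =
     merge_weight q y k * merge_factor q ys k + (\<Sum>j\<in>{1..<k}. lead_weight q y j * merge_factor q ys j)"

lemma snum_plus_sgn: "snum_sgn (snum_plus s s') = snum_sgn s * snum_sgn s'"
  by (cases s; cases s') auto

lemma snum_plus_abs: "snum_abs (snum_plus s s') = snum_abs s + snum_abs s'"
  by (cases s; cases s') auto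

lemma lead_weight_merge:
  assumes "q > 0" "Q_exp (zth_plus r r') k = Q_exp r k + Q_lin r' k"
  shows "lead_weight q (snum_plus s s', t + t', zth_plus r r') k
       = lead_weight q (s, t, r) k * merge_weight q (s', t', r') k"
proof -
  have "int (t + t') * int k + Q_exp (zth_plus r r') k
      = (int t * int k + Q_exp r k) + (int t' * int k + Q_lin r' k)"
    by (simp add: assms algebra_simps)
  then have "q powi (int (t + t') * int k + Q_exp (zth_plus r r') k)
      = q powi (int t * int k + Q_exp r k) * q powi (int t' * int k + Q_lin r' k)"
    using \<open>q > 0\<close> by (simp add: power_int_add)
  then show ?thesis
    by (simp add: snum_plus_sgn snum_plus_abs power_mult_distrib power_add)
qed

lemma sum_bool_lists_Suc:
  fixes G :: "bool list \<Rightarrow> real"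
  shows "(\<Sum>cs | length cs = Suc m. G cs) =
    (\<Sum>cs | length cs = m. G (True # cs)) + (\<Sum>cs | length cs = m. G (False # cs))"
proof -
  have fin: "finite {cs :: bool list. length cs = m}" for m
    using finite_lists_length_eq[of "UNIV :: bool set" m] by simp
  have "{cs :: bool list. length cs = Suc m} =
      (#) True ` {cs. length cs = m} \<union> (#) False ` {cs. length cs = m}"
    by (auto simp: length_Suc_conv image_iff)
  then show ?thesis
    by (simp, subst sum.union_disjoint) (auto simp: fin sum.reindex)
qed

text \<open>Induction over the entries behind the head. A merge changes the head, so
  \<open>s\<close>, \<open>t\<close>, \<open>r\<close> vary; a comma leaves an inner sum with factor
  1 and bound \<open>k - 1\<close>, so \<open>F\<close> and \<open>n\<close> vary too.\<close>

lemma sum_merge_runs_H_strict: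
  assumes "q > 0" "box_linear r (map (snd \<circ> snd) T)"
  shows "(\<Sum>cs | length cs = length T. H_strict F q n
            (merge_runs snum_plus (s # map fst T) cs) (merge_runs (+) (t # map (fst \<circ> snd) T) cs)
            (merge_runs zth_plus (r # map (snd \<circ> snd) T) cs))
       = (\<Sum>k=1..n. F k * lead_weight q (s, t, r) k * merge_factor q T k)"
  using assms(2)
proof (induction T arbitrary: s t r F n)
  case Nil
  then show ?case by (simp add: H_strict_Cons H_strict_Nil del: lead_weight.simps)
next
  case (Cons y T)
  obtain s' t' r' where y: "y = (s', t', r')" by (cases y)
  from Cons.prems y have lin: "\<And>k. Q_exp (zth_plus r r') k = Q_exp r k + Q_lin r' k"
    and ok: "box_linear (zth_plus r r') (map (snd \<circ> snd) T)" "box_linear r' (map (snd \<circ> snd) T)"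
    by (simp_all add: comp_def)
  let ?H = "\<lambda>F n s t r cs. H_strict F q n (merge_runs snum_plus (s # map fst T) cs)
    (merge_runs (+) (t # map (fst \<circ> snd) T) cs) (merge_runs zth_plus (r # map (snd \<circ> snd) T) cs)"
  have iv: "{1..k - 1} = {1..<k}" for k :: nat by auto
  have "(\<Sum>cs | length cs = length T. \<Sum>k=1..n. F k * lead_weight q (s, t, r) k * ?H (\<lambda>_. 1) (k - 1) s' t' r' cs)
      = (\<Sum>k=1..n. F k * lead_weight q (s, t, r) k * (\<Sum>cs | length cs = length T. ?H (\<lambda>_. 1) (k - 1) s' t' r' cs))"
    by (subst sum.swap) (simp only: sum_distrib_left)
  also have "\<dots> = (\<Sum>k=1..n. F k * lead_weight q (s, t, r) k
      * (\<Sum>j\<in>{1..<k}. lead_weight q y j * merge_factor q T j))"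
    by (simp only: Cons.IH[OF ok(2)] iv y mult_1)
  finally have comma: "(\<Sum>cs | length cs = length T. \<Sum>k=1..n. F k * lead_weight q (s, t, r) k * ?H (\<lambda>_. 1) (k - 1) s' t' r' cs)
      = (\<Sum>k=1..n. F k * lead_weight q (s, t, r) k
      * (\<Sum>j\<in>{1..<k}. lead_weight q y j * merge_factor q T j))" .
  have merge: "(\<Sum>cs | length cs = length T. ?H F n (snum_plus s s') (t + t') (zth_plus r r') cs)
      = (\<Sum>k=1..n. F k * lead_weight q (s, t, r) k * (merge_weight q y k * merge_factor q T k))"
    unfolding Cons.IH[OF ok(1)] lead_weight_merge[OF \<open>q > 0\<close> lin] y
    by (simp only: mult.assoc)
  have "(\<Sum>k=1..n. F k * lead_weight q (s, t, r) k * merge_factor q (y # T) k)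
      = (\<Sum>cs | length cs = length T. ?H F n (snum_plus s s') (t + t') (zth_plus r r') cs)
      + (\<Sum>cs | length cs = length T. \<Sum>k=1..n. F k * lead_weight q (s, t, r) k * ?H (\<lambda>_. 1) (k - 1) s' t' r' cs)"
    unfolding comma merge by (simp only: merge_factor.simps distrib_left sum.distrib)
  then show ?case
    by (simp add: sum_bool_lists_Suc y H_strict_Cons comp_def
        del: lead_weight.simps merge_weight.simps merge_factor.simps)
qed


section \<open>The quotient \<open>B n k\<close>, its recurrences and two telescoping sums\<close>

locale q_unit =
  fixes q :: real
  assumes q_pos: "0 < q" and q_less: "q < 1"
begin

abbreviation "qn \<equiv> q_num q"

definition B :: "nat \<Rightarrow> nat \<Rightarrow> real" where
  "B n k = q_binom q n k / q_binom q (n + k) k"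

definition \<tau> :: "nat \<Rightarrow> real" where
  "\<tau> k = q ^ (k choose 2)"

lemma \<tau>_0 [simp]: "\<tau> 0 = 1"
  by (simp add: \<tau>_def numeral_2_eq_2)

lemma \<tau>_Suc: "\<tau> (Suc k) = q ^ k * \<tau> k"
  by (simp add: \<tau>_def numeral_2_eq_2 power_add)

lemma \<tau>_pos: "\<tau> k > 0"
  using q_pos by (simp add: \<tau>_def)

lemma \<tau>_nz [simp]: "\<tau> k \<noteq> 0"
  using \<tau>_pos[of k] by simp

lemma q_nz [simp]: "q \<noteq> 0"
  using q_pos by simp

lemma q_pow_less: "k \<ge> 1 \<Longrightarrow> q ^ k < 1"
  using q_pos q_less by (simp add: power_less_one_iff)

lemma qn_nz: "k \<ge> 1 \<Longrightarrow> qn k \<noteq> 0"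
  using q_pow_less[of k] q_less by (simp add: q_num_def)

lemma qn_0 [simp]: "qn 0 = 0"
  by (simp add: q_num_def)

lemma poch_Suc: "q_poch q q (Suc n) = q_poch q q n * (1 - q ^ Suc n)"
  by (simp add: q_poch_def)

lemma poch_nz: "q_poch q q n \<noteq> 0"
proof (induction n)
  case (Suc n)
  then show ?case using q_pow_less[of "Suc n"] by (simp add: poch_Suc del: power_Suc)
qed (simp add: q_poch_def)

lemma B_eq: "k \<le> n \<Longrightarrow> B n k = q_poch q q n ^ 2 / (q_poch q q (n - k) * q_poch q q (n + k))"
  using poch_nz[of k] by (simp add: B_def q_binom_def power2_eq_square)

lemma B_0 [simp]: "B n 0 = 1"
  using poch_nz[of n] by (simp add: B_eq power2_eq_square)

lemma B_gt [simp]: "k > n \<Longrightarrow> B n k = 0"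
  by (simp add: B_def q_binom_def)

lemma B_Suc_right:
  assumes "k < n"
  shows "B n k * (1 - q ^ (n - k)) = B n (Suc k) * (1 - q ^ (n + Suc k))"
proof -
  obtain d where d: "n = Suc (k + d)" using assms less_iff_Suc_add by auto
  have "n - k = Suc d" "n - Suc k = d" "n + Suc k = Suc (n + k)" by (simp_all add: d)
  then show ?thesis
    using poch_nz[of d] poch_nz[of "n + k"] q_pow_less[of "Suc d"] q_pow_less[of "Suc (n + k)"] assms
    by (simp add: B_eq poch_Suc divide_simps del: power_Suc)
qed

lemma B_Suc_left:
  assumes "1 \<le> k" "k \<le> Suc n"
  shows "(1 - q ^ Suc n)\<^sup>2 * B n k = (1 - q ^ (Suc n - k)) * (1 - q ^ (Suc n + k)) * B (Suc n) k"
\<comment> \<open>At \<open>k = Suc n\<close> both sides vanish; below that, \<open>B_eq\<close>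
  applies to both quotients.\<close>
proof (cases "k = Suc n")
  case False
  then obtain d where d: "n = k + d" using assms(2) by (metis le_SucE le_iff_add)
  have "Suc n - k = Suc d" "n - k = d" "Suc n + k = Suc (n + k)" by (simp_all add: d)
  then show ?thesis
    using poch_nz[of d] poch_nz[of "n + k"] q_pow_less[of "Suc d"] q_pow_less[of "Suc (n + k)"] d
    by (simp add: B_eq poch_Suc divide_simps power_mult_distrib del: power_Suc)
qed simp

text \<open>Eliminating \<open>B n k\<close> by \<open>B_Suc_left\<close> leaves the identity
  y(1-x)^2 - (y-x)(1-xy) = x(1-y)^2 with x = q^(n+1), y = q^k. It trades a weight in
  \<open>k\<close> for a weight in \<open>n\<close> alone.\<close>

lemma B_diff:
  assumes "1 \<le> k"
  shows "q ^ k * (B (Suc n) k - B n k) / qn k ^ 2 = q ^ Suc n / qn (Suc n) ^ 2 * B (Suc n) k"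
proof (cases "k \<le> Suc n")
  case True
  define x where "x = q ^ Suc n"
  define y where "y = q ^ k"
  have xy: "q ^ (Suc n - k) = x / y" "q ^ (Suc n + k) = x * y" "y \<noteq> 0" "1 - x \<noteq> 0" "1 - y \<noteq> 0"
    using True q_pow_less[of "Suc n"] q_pow_less[of k] assms
    by (simp_all add: x_def y_def power_diff power_add[symmetric] del: power_Suc)
  have "(1 - x)\<^sup>2 * B n k = (1 - x / y) * (1 - x * y) * B (Suc n) k"
    using B_Suc_left[OF assms True] xy by (simp add: x_def y_def)
  moreover have "y * (1 - x)\<^sup>2 * (B (Suc n) k - B n k)
      = y * (1 - x)\<^sup>2 * B (Suc n) k - y * ((1 - x)\<^sup>2 * B n k)"
    by (simp only: right_diff_distrib mult.assoc)
  ultimately have "y * (1 - x)\<^sup>2 * (B (Suc n) k - B n k)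
      = (y * (1 - x)\<^sup>2 - y * (1 - x / y) * (1 - x * y)) * B (Suc n) k"
    by (simp only: left_diff_distrib mult.assoc)
  also have "y * (1 - x)\<^sup>2 - y * (1 - x / y) * (1 - x * y) = x * (1 - y)\<^sup>2"
    using xy(3) by (simp add: field_simps power2_eq_square)
  finally have "y * (1 - x)\<^sup>2 * (B (Suc n) k - B n k) = x * (1 - y)\<^sup>2 * B (Suc n) k" .
  then have "y * (B (Suc n) k - B n k) / (1 - y)\<^sup>2 = x / (1 - x)\<^sup>2 * B (Suc n) k"
    using xy by (simp add: field_simps)
  then have "y * (B (Suc n) k - B n k) / (1 - y)\<^sup>2 * (1 - q)\<^sup>2
      = x / (1 - x)\<^sup>2 * B (Suc n) k * (1 - q)\<^sup>2"
    by (rule arg_cong)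
  then show ?thesis
    by (simp add: q_num_def x_def[symmetric] y_def[symmetric] power_divide mult_ac del: power_Suc)
qed simp

text \<open>The right side drops by the summand for \<open>k = Suc j\<close> when \<open>j\<close>
  is replaced by \<open>Suc j\<close>, by the ratio in \<open>B_Suc_right\<close>. The induction
  descends from \<open>j = n\<close>, where both sides vanish.\<close>

lemma sum_B_alternating:
  assumes "j \<le> n" "n \<ge> 1"
  shows "(\<Sum>k\<in>{j<..n}. B n k * ((-1) ^ k * \<tau> k * (1 + q ^ k))) = (-1) ^ j * \<tau> j * B n j * (qn j / qn n - 1)"
  using assms(1)
proof (induction j rule: inc_induct)
  case base
  then show ?case using qn_nz[OF assms(2)] by simp
next
  case (step j)
  have set: "{j<..n} = insert (Suc j) {Suc j<..n}" using step.hyps by auto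
  define x where "x = q ^ n"
  define y where "y = q ^ j"
  have xy: "q ^ (n - j) = x / y" "q ^ (n + Suc j) = x * y * q" "y \<noteq> 0" "1 - x \<noteq> 0"
    using step.hyps q_pow_less[of n] by (auto simp: x_def y_def power_diff power_add)
  have "B n j * (1 - x / y) = B n (Suc j) * (1 - x * y * q)"
    using B_Suc_right[OF step.hyps(2)] xy by simp
  then have 1: "B n j * (y - x) = y * (B n (Suc j) * (1 - x * y * q))"
    using xy(3) by (simp add: field_simps)
  have r: "qn j / qn n - 1 = - (y - x) / (1 - x)" "qn (Suc j) / qn n - 1 = - (y * q - x) / (1 - x)"
    using q_less xy(4) by (auto simp: q_num_def x_def[symmetric] y_def[symmetric] divide_simps)
  have "B n (Suc j) * ((-1) ^ Suc j * \<tau> (Suc j) * (1 + q ^ Suc j))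
      + (-1) ^ Suc j * \<tau> (Suc j) * B n (Suc j) * (qn (Suc j) / qn n - 1)
      = - ((-1) ^ j * \<tau> j * (y * (B n (Suc j) * ((1 + y * q) - (y * q - x) / (1 - x)))))"
    unfolding r using xy(4) by (simp add: \<tau>_Suc y_def[symmetric] field_simps)
  also have "(1 + y * q) - (y * q - x) / (1 - x) = (1 - x * y * q) / (1 - x)"
    using xy(4) by (simp add: field_simps)
  also have "- ((-1) ^ j * \<tau> j * (y * (B n (Suc j) * ((1 - x * y * q) / (1 - x)))))
      = - ((-1) ^ j * \<tau> j * (y * (B n (Suc j) * (1 - x * y * q))) / (1 - x))"
    by simp
  also have "\<dots> = (-1) ^ j * \<tau> j * B n j * (qn j / qn n - 1)"
    unfolding 1[symmetric] r using xy(4) by (simp add: field_simps)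
  finally show ?case unfolding set using step.IH by simp
qed

text \<open>The same downward telescoping, now with the boundary factor \<open>qn n - qn j\<close>,
  which vanishes at \<open>j = n\<close>.\<close>

lemma sum_B_square:
  assumes "j \<le> n"
  shows "(\<Sum>k\<in>{j<..n}. B n k * (qn k * (\<tau> k ^ 2 * (1 + q ^ k)))) = (qn n - qn j) * (\<tau> j ^ 2 * q ^ j) * B n j"
  using assms
proof (induction j rule: inc_induct)
  case base
  then show ?case by simp
next
  case (step j)
  have set: "{j<..n} = insert (Suc j) {Suc j<..n}" using step.hyps by auto
  define x where "x = q ^ n"
  define y where "y = q ^ j"
  have xy: "q ^ (n - j) = x / y" "q ^ (n + Suc j) = x * y * q" "y \<noteq> 0"
    using step.hyps by (auto simp: x_def y_def power_diff power_add)
  have "B n j * (1 - x / y) = B n (Suc j) * (1 - x * y * q)"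
    using B_Suc_right[OF step.hyps(2)] xy by simp
  then have 1: "(y - x) * B n j = y * (1 - x * y * q) * B n (Suc j)"
    using xy(3) by (simp add: field_simps)
  have q1: "1 - q \<noteq> 0" using q_less by simp
  have r: "qn n - qn j = (y - x) / (1 - q)" "qn n - qn (Suc j) = (y * q - x) / (1 - q)"
    "qn (Suc j) = (1 - y * q) / (1 - q)"
    using q1 by (auto simp: q_num_def x_def[symmetric] y_def[symmetric] divide_simps)
  have "B n (Suc j) * (qn (Suc j) * (\<tau> (Suc j) ^ 2 * (1 + q ^ Suc j)))
      + (qn n - qn (Suc j)) * (\<tau> (Suc j) ^ 2 * q ^ Suc j) * B n (Suc j)
      = \<tau> j ^ 2 * y * (y * ((1 - y * q) * (1 + y * q) + (y * q - x) * (y * q)) * B n (Suc j)) / (1 - q)"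
    unfolding r(2) unfolding r(3) divide_inverse
    by (simp add: \<tau>_Suc y_def[symmetric] algebra_simps power2_eq_square)
  also have "(1 - y * q) * (1 + y * q) + (y * q - x) * (y * q) = 1 - x * y * q"
    by (simp add: algebra_simps)
  also have "\<tau> j ^ 2 * y * (y * (1 - x * y * q) * B n (Suc j)) / (1 - q)
      = (qn n - qn j) * (\<tau> j ^ 2 * q ^ j) * B n j"
    unfolding 1[symmetric] r y_def[symmetric] by simp
  finally show ?case unfolding set using step.IH by simp
qed

section \<open>Expansions in \<open>B n k\<close> and the operations on them\<close>

definition B_expansion :: "(nat \<Rightarrow> real) \<Rightarrow> (nat \<Rightarrow> real) \<Rightarrow> bool" where
  "B_expansion f w \<longleftrightarrow> (\<forall>n\<ge>1. f n = (\<Sum>k=1..n. B n k * w k))"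

lemma B_expansion_cong:
  assumes "B_expansion f w" "\<And>n. n \<ge> 1 \<Longrightarrow> f n = g n" "\<And>k. k \<ge> 1 \<Longrightarrow> w k = v k"
  shows "B_expansion g v"
  using assms unfolding B_expansion_def by (auto intro!: sum.cong)

text \<open>At \<open>j = 0\<close> the alternating sum equals -1, since \<open>qn 0 = 0\<close>.
  This expansion fails at \<open>n = 0\<close>, where the sum is empty; hence the restriction to
  \<open>n \<ge> 1\<close> in \<open>B_expansion\<close>.\<close>

lemma B_expansion_one: "B_expansion (\<lambda>_. 1) (\<lambda>k. - ((-1) ^ k * \<tau> k * (1 + q ^ k)))"
proof -
  have "{0<..n} = {1..n}" for n :: nat by auto
  then show ?thesis unfolding B_expansion_def
    using sum_B_alternating[of 0] by (simp add: sum_negf)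
qed

lemma sum_triangle:
  fixes g h :: "nat \<Rightarrow> real"
  shows "(\<Sum>k=1..n. g k * (\<Sum>j\<in>{1..<k}. h j)) = (\<Sum>j=1..n. h j * (\<Sum>k\<in>{j<..n}. g k))"
proof -
  have "(\<Sum>k=1..n. g k * (\<Sum>j\<in>{1..<k}. h j)) = (\<Sum>k\<in>{1..n}. \<Sum>j\<in>{j \<in> {1..n}. j < k}. h j * g k)"
    by (auto simp: sum_distrib_left mult.commute intro!: sum.cong)
  also have "\<dots> = (\<Sum>j\<in>{1..n}. \<Sum>k\<in>{k \<in> {1..n}. j < k}. h j * g k)"
    by (rule sum.swap_restrict) auto
  also have "\<dots> = (\<Sum>j=1..n. h j * (\<Sum>k\<in>{j<..n}. g k))"
    unfolding sum_distrib_left by (intro sum.cong) auto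
  finally show ?thesis .
qed

text \<open>After interchanging the double sum, \<open>sum_B_square\<close> gives ([n] - [j]) w j B
  n j, the divisor \<tau>^2 q^j cancelling; the diagonal term [j] w j B n j completes this to [n] w
  j B n j.\<close>

lemma B_expansion_mult:
  assumes "B_expansion f w"
  shows "B_expansion (\<lambda>n. qn n * f n)
    (\<lambda>k. qn k * (w k + \<tau> k ^ 2 * (1 + q ^ k) * (\<Sum>j\<in>{1..<k}. w j / (\<tau> j ^ 2 * q ^ j))))"
  unfolding B_expansion_def
proof (intro allI impI)
  fix n :: nat assume "n \<ge> 1"
  have "(\<Sum>k=1..n. B n k * (qn k * (w k + \<tau> k ^ 2 * (1 + q ^ k) * (\<Sum>j\<in>{1..<k}. w j / (\<tau> j ^ 2 * q ^ j)))))
    = (\<Sum>k=1..n. B n k * qn k * w k)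
      + (\<Sum>k=1..n. (B n k * (qn k * (\<tau> k ^ 2 * (1 + q ^ k)))) * (\<Sum>j\<in>{1..<k}. w j / (\<tau> j ^ 2 * q ^ j)))"
    unfolding sum.distrib[symmetric] by (intro sum.cong refl) (simp add: algebra_simps)
  also have "\<dots> = (\<Sum>k=1..n. B n k * qn k * w k + w k / (\<tau> k ^ 2 * q ^ k) * ((qn n - qn k) * (\<tau> k ^ 2 * q ^ k) * B n k))"
    unfolding sum_triangle sum.distrib by (intro arg_cong2[of _ _ _ _ "(+)"] sum.cong refl) (simp add: sum_B_square)
  also have "\<dots> = (\<Sum>k=1..n. qn n * (B n k * w k))"
    by (intro sum.cong refl) (simp add: field_simps)
  also have "\<dots> = qn n * f n"
    using assms \<open>n \<ge> 1\<close> by (simp add: B_expansion_def sum_distrib_left)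
  finally show "qn n * f n = (\<Sum>k=1..n. B n k * (qn k * (w k + \<tau> k ^ 2 * (1 + q ^ k) * (\<Sum>j\<in>{1..<k}. w j / (\<tau> j ^ 2 * q ^ j)))))"
    by simp
qed

text \<open>The same interchange with \<open>sum_B_alternating\<close>: the inner sum yields the
  factor [j]/[n] - 1, and the diagonal term removes the -1.\<close>

lemma B_expansion_divide:
  assumes "B_expansion f (\<lambda>k. (-1) ^ k * \<tau> k * (1 + q ^ k) * y k)"
  shows "B_expansion (\<lambda>n. f n / qn n)
    (\<lambda>k. (-1) ^ k * \<tau> k * (1 + q ^ k) * (y k / qn k + (\<Sum>j\<in>{1..<k}. (1 + q ^ j) * y j / qn j)))"
  unfolding B_expansion_def
proof (intro allI impI)
  fix n :: nat assume n: "n \<ge> 1"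
  let ?g = "\<lambda>k. (-1) ^ k * \<tau> k * (1 + q ^ k)"
  have "(\<Sum>k=1..n. B n k * (?g k * (y k / qn k + (\<Sum>j\<in>{1..<k}. (1 + q ^ j) * y j / qn j))))
    = (\<Sum>k=1..n. B n k * ?g k * y k / qn k)
      + (\<Sum>k=1..n. (B n k * ?g k) * (\<Sum>j\<in>{1..<k}. (1 + q ^ j) * y j / qn j))"
    unfolding sum.distrib[symmetric]
    by (intro sum.cong refl) (simp only: distrib_left[of _ "_ / _"] distrib_left[of "B n _"] mult.assoc times_divide_eq_right)
  also have "\<dots> = (\<Sum>k=1..n. B n k * ?g k * y k / qn k
      + (1 + q ^ k) * y k / qn k * ((-1) ^ k * \<tau> k * B n k * (qn k / qn n - 1)))"
    unfolding sum_triangle sum.distrib using n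
    by (intro arg_cong2[of _ _ _ _ "(+)"] sum.cong refl) (simp add: sum_B_alternating)
  also have "\<dots> = (\<Sum>k=1..n. (B n k * (?g k * y k)) / qn n)"
    using n qn_nz by (intro sum.cong refl) (simp add: field_simps)
  also have "\<dots> = f n / qn n"
    using assms n by (simp add: B_expansion_def sum_divide_distrib)
  finally show "f n / qn n = (\<Sum>k=1..n. B n k * (?g k * (y k / qn k + (\<Sum>j\<in>{1..<k}. (1 + q ^ j) * y j / qn j))))"
    by simp
qed

text \<open>Both sides vanish at \<open>n = 0\<close> and, by \<open>B_diff\<close>, have equal
  increments in \<open>n\<close>.\<close>

lemma B_expansion_two:
  assumes "B_expansion f w"
  shows "B_expansion (\<lambda>n. \<Sum>k=1..n. q ^ k / qn k ^ 2 * f k) (\<lambda>k. q ^ k / qn k ^ 2 * w k)"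
proof -
  have "(\<Sum>k=1..n. q ^ k / qn k ^ 2 * f k) = (\<Sum>k=1..n. B n k * (q ^ k / qn k ^ 2 * w k))" for n
  proof (induction n)
    case (Suc n)
    \<comment> \<open>The second sum may be extended to \<open>Suc n\<close> because
      \<open>B n (Suc n) = 0\<close>.\<close>
    have "(\<Sum>k=1..Suc n. B (Suc n) k * (q ^ k / qn k ^ 2 * w k)) - (\<Sum>k=1..n. B n k * (q ^ k / qn k ^ 2 * w k))
      = (\<Sum>k=1..Suc n. (B (Suc n) k - B n k) * (q ^ k / qn k ^ 2 * w k))"
      by (simp only: left_diff_distrib sum_subtractf) simp
    also have "\<dots> = (\<Sum>k=1..Suc n. q ^ k * (B (Suc n) k - B n k) / qn k ^ 2 * w k)"
      by (intro sum.cong refl) simp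
    also have "\<dots> = (\<Sum>k=1..Suc n. q ^ Suc n / qn (Suc n) ^ 2 * (B (Suc n) k * w k))"
      by (intro sum.cong refl) (simp only: B_diff atLeastAtMost_iff mult.assoc)
    also have "\<dots> = q ^ Suc n / qn (Suc n) ^ 2 * f (Suc n)"
      using assms by (simp only: B_expansion_def sum_distrib_left[symmetric])
    finally show ?case using Suc.IH by simp
  qed simp
  then show ?thesis unfolding B_expansion_def by blast
qed

section \<open>Weights of entries, and prepending 1, 2 or \<open>c\<close> to the argument of
  \<open>H_star\<close>\<close>

lemma powi_add_nat:
  "q powi (int t * int k + i) = q ^ (t * k) * q powi i"
  "q powi (int t * int k - i) = q ^ (t * k) * q powi (- i)"
  by (simp_all add: power_int_add power_int_diff power_int_minus divide_inverse flip: of_nat_mult)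

lemma powi_choose: "q powi int (k choose 2) = \<tau> k" "q powi (- int (k choose 2)) = 1 / \<tau> k"
    "q powi (2 * int (k choose 2)) = \<tau> k ^ 2" "q powi (- int (k choose 2) - int k) = 1 / (\<tau> k * q ^ k)"
proof -
  have "q powi (2 * int (k choose 2)) = q ^ (2 * (k choose 2))"
    by (metis of_nat_mult of_nat_numeral power_int_of_nat)
  then show "q powi (2 * int (k choose 2)) = \<tau> k ^ 2"
    by (simp add: \<tau>_def mult.commute flip: power_mult)
  show "q powi (- int (k choose 2)) = 1 / \<tau> k"
    by (simp add: \<tau>_def power_int_minus divide_inverse)
  then show "q powi (- int (k choose 2) - int k) = 1 / (\<tau> k * q ^ k)"
    by (simp add: power_int_diff)
qed (simp add: \<tau>_def)

lemma merge_weight_eqs: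
  "merge_weight q (Barred s, t, Z 1) k = (-1) ^ k * q ^ (t * k) * \<tau> k / qn k ^ s"
  "merge_weight q (Barred s, t, Z (-1)) k = (-1) ^ k * q ^ (t * k) / (\<tau> k * qn k ^ s)"
  "merge_weight q (Plain 1, 0, Theta) k = 1 / qn k"
  by (simp_all add: powi_add_nat powi_choose, simp add: \<tau>_def)

lemma lead_weight_eqs:
  "lead_weight q (Barred s, t, Z 1) k = (1 + q ^ k) * ((-1) ^ k * q ^ (t * k) * \<tau> k / qn k ^ s)"
  "lead_weight q (Barred s, t, Z (-1)) k = (1 + q ^ k) * merge_weight q (Barred s, t, Z (-1)) k / q ^ k"
  "lead_weight q (Plain 1, 0, Theta) k = (1 + q ^ k) / qn k"
  "lead_weight q (Plain s, t, Z 2) k = (1 + q ^ k) * (q ^ (t * k) * \<tau> k ^ 2 / qn k ^ s)"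
  by (simp_all add: powi_add_nat powi_choose Q_exp_eq, simp add: \<tau>_def, simp add: mult_ac)

declare lead_weight.simps [simp del] merge_weight.simps [simp del]

lemma B_expansion_twos:
  assumes "B_expansion (\<lambda>n. H_star q n ss) w"
  shows "B_expansion (\<lambda>n. H_star q n (replicate m (Plain 2) @ ss)) (\<lambda>k. (q ^ k / qn k ^ 2) ^ m * w k)"
proof (induction m)
  case 0
  then show ?case using assms by simp
next
  case (Suc m)
  from B_expansion_two[OF Suc.IH] show ?case
    by (rule B_expansion_cong) (simp_all add: H_star_Cons)
qed

text \<open>Prepending 1 is multiplying by [n] and then prepending 2. The former leading entry moves
  into the merge factor with \<open>Z (-1)\<close> in place of \<open>Z 1\<close>; the freed
  \<tau>^2 (1 + q^k) is left for the entry that will lead next.\<close>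

lemma B_expansion_one_Cons:
  assumes "B_expansion (\<lambda>n. H_star q n ss)
    (\<lambda>k. - (lead_weight q (Barred s, t, Z 1) k * merge_factor q M k))"
  shows "B_expansion (\<lambda>n. H_star q n (Plain 1 # ss))
    (\<lambda>k. - (q ^ k / qn k * (\<tau> k ^ 2 * (1 + q ^ k) * merge_factor q ((Barred s, t, Z (-1)) # M) k)))"
proof (rule B_expansion_cong[OF B_expansion_two[OF B_expansion_mult[OF assms]]])
  fix n :: nat
  show "(\<Sum>k=1..n. q ^ k / qn k ^ 2 * (qn k * H_star q k ss)) = H_star q n (Plain 1 # ss)"
    unfolding H_star_Cons by (intro sum.cong refl) (simp add: power2_eq_square)
next
  fix k :: nat
  let ?u = "\<lambda>j. merge_weight q (Barred s, t, Z (-1)) j * merge_factor q M j"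
  \<comment> \<open>Passing from \<open>Z 1\<close> to \<open>Z (-1)\<close> replaces \<tau> by
    1/\<tau>, so \<tau>^2 comes out. The correction in \<open>Q_exp (Z (-1))\<close> accounts for
    the 1/q^j in \<open>B_expansion_mult\<close>.\<close>
  have lead: "- (lead_weight q (Barred s, t, Z 1) j * merge_factor q M j) = - (\<tau> j ^ 2 * (1 + q ^ j) * ?u j)" for j
    by (simp add: lead_weight_eqs merge_weight_eqs power2_eq_square)
  have "(\<Sum>j\<in>{1..<k}. - (\<tau> j ^ 2 * (1 + q ^ j) * ?u j) / (\<tau> j ^ 2 * q ^ j))
      = - (\<Sum>j\<in>{1..<k}. lead_weight q (Barred s, t, Z (-1)) j * merge_factor q M j)"
    unfolding sum_negf[symmetric]
    by (intro sum.cong refl) (simp add: lead_weight_eqs)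
  then show "q ^ k / qn k ^ 2 * (qn k * (- (lead_weight q (Barred s, t, Z 1) k * merge_factor q M k) +
      \<tau> k ^ 2 * (1 + q ^ k) * (\<Sum>j\<in>{1..<k}. - (lead_weight q (Barred s, t, Z 1) j * merge_factor q M j) / (\<tau> j ^ 2 * q ^ j))))
    = - (q ^ k / qn k * (\<tau> k ^ 2 * (1 + q ^ k) * merge_factor q ((Barred s, t, Z (-1)) # M) k))"
    unfolding lead by (simp add: power2_eq_square algebra_simps)
qed

text \<open>The first division by [n] raises the exponent \<open>s\<close> by one and moves that
  entry into the merge factor; each of the \<open>e\<close> further divisions adds one
  \<open>Theta\<close> entry.\<close>

lemma B_expansion_thetas:
  assumes "B_expansion f (\<lambda>k. (-1) ^ k * \<tau> k * (1 + q ^ k)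
    * - ((-1) ^ k * q ^ (t * k) * \<tau> k / qn k ^ s * merge_factor q T k))"
  shows "B_expansion (\<lambda>n. f n / qn n ^ Suc e) (\<lambda>k. (-1) ^ k * \<tau> k * (1 + q ^ k)
    * - merge_factor q (replicate e (Plain 1, 0, Theta) @ (Barred (Suc s), t, Z 1) # T) k)"
proof (induction e)
  case 0
  from B_expansion_divide[OF assms] show ?case
    by (rule B_expansion_cong)
       (simp_all add: merge_weight_eqs lead_weight_eqs sum_negf mult_ac)
next
  case (Suc e)
  from B_expansion_divide[OF Suc.IH] show ?case
    by (rule B_expansion_cong)
       (simp_all add: merge_weight_eqs[unfolded One_nat_def] lead_weight_eqs[unfolded One_nat_def] sum_negf mult_ac)
qed

text \<open>With \<open>c = e + 3\<close>, prepending \<open>c\<close> means dividing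
  \<open>c - 2 = Suc e\<close> times by [n] and then prepending 2.\<close>

lemma B_expansion_block:
  assumes "B_expansion (\<lambda>n. H_star q n (Plain 1 # ss))
    (\<lambda>k. - (q ^ k / qn k * (\<tau> k ^ 2 * (1 + q ^ k) * merge_factor q T k)))"
  shows "B_expansion
    (\<lambda>n. H_star q n (replicate b (Plain 2) @ Plain (e + 3) # replicate a (Plain 2) @ Plain 1 # ss))
    (\<lambda>k. - (lead_weight q (Barred (2 * b + 2), b + 1, Z 1) k
      * merge_factor q (replicate e (Plain 1, 0, Theta) @ (Barred (2 * a + 2), a + 1, Z 1) # T) k))"
proof -
  let ?f = "\<lambda>n. H_star q n (replicate a (Plain 2) @ Plain 1 # ss)"
  let ?M = "replicate e (Plain 1, 0, Theta) @ (Barred (Suc (2 * a + 1)), a + 1, Z 1) # T"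
  \<comment> \<open>The \<tau>^2 left by the entry 1 is split: one \<tau> stays in the common
    alternating factor, the other goes to the entry for the 2s. The two signs cancel.\<close>
  have "B_expansion ?f (\<lambda>k. (-1) ^ k * \<tau> k * (1 + q ^ k)
    * - ((-1) ^ k * q ^ ((a + 1) * k) * \<tau> k / qn k ^ (2 * a + 1) * merge_factor q T k))"
    by (rule B_expansion_cong[OF B_expansion_twos[OF assms, of a]])
       (simp_all add: power_divide power2_eq_square[of "\<tau> _"] power_add mult_ac flip: power_mult)
  from B_expansion_two[OF B_expansion_thetas[OF this, of e]]
  have "B_expansion (\<lambda>n. H_star q n (Plain (e + 3) # replicate a (Plain 2) @ Plain 1 # ss))
    (\<lambda>k. q ^ k / qn k ^ 2 * ((-1) ^ k * \<tau> k * (1 + q ^ k) * - merge_factor q ?M k))"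
    by (rule B_expansion_cong)
       (simp_all add: H_star_Cons eval_nat_numeral mult_ac)
  from B_expansion_twos[OF this, of b] show ?thesis
    by (rule B_expansion_cong)
       (simp_all add: lead_weight_eqs power_divide power_add power_mult_distrib power2_eq_square
          mult_2_right mult_ac flip: power_mult)
qed

end

text \<open>Case (A) replaces the first \<open>Z (-1)\<close> of \<open>p_tail 1 l a b c\<close> by \<open>Z 1\<close>.\<close>

definition p_tail ::
    "nat \<Rightarrow> nat \<Rightarrow> (nat \<Rightarrow> nat) \<Rightarrow> (nat \<Rightarrow> nat) \<Rightarrow> (nat \<Rightarrow> nat) \<Rightarrow> (snum \<times> nat \<times> zth) list" where
  "p_tail i l a b c =
     concat (map (\<lambda>j. (Barred (2 * b j + 2), b j + 1, Z (-1))
         # replicate (c j - 3) (Plain 1, 0, Theta) @ [(Barred (2 * a j + 2), a j + 1, Z 1)]) [i..<l + 1])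
     @ [(Barred (2 * a (l + 1)), a (l + 1), Z (-1))]"

lemma p_tail_Cons:
  "i \<le> l \<Longrightarrow> p_tail i l a b c = (Barred (2 * b i + 2), b i + 1, Z (-1))
     # replicate (c i - 3) (Plain 1, 0, Theta) @ (Barred (2 * a i + 2), a i + 1, Z 1) # p_tail (Suc i) l a b c"
  unfolding p_tail_def by (simp add: upt_conv_Cons del: upt_Suc)

lemma p_tail_proj:
  "map fst (p_tail 1 l a b c) = p1_tail l a b c"
  "map (fst \<circ> snd) (p_tail 1 l a b c) = p2_tail l a b c"
  "map (snd \<circ> snd) (p_tail i l a b c) = p3_tail i l c"
  by (simp_all add: p_tail_def p1_tail_def p2_tail_def p3_tail_def map_concat comp_def del: upt_Suc)

text \<open>The variable starting block \<open>i\<close> makes a downward induction over the blocks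
  possible.\<close>

definition s_from :: "nat \<Rightarrow> nat \<Rightarrow> (nat \<Rightarrow> nat) \<Rightarrow> (nat \<Rightarrow> nat) \<Rightarrow> (nat \<Rightarrow> nat) \<Rightarrow> snum list" where
  "s_from i l a b c =
     concat (map (\<lambda>j. replicate (b j) (Plain 2) @ [Plain (c j)] @ replicate (a j) (Plain 2) @ [Plain 1])
       [i..<l + 1])
     @ replicate (a (l + 1)) (Plain 2)"

lemma s_from_Cons:
  "i \<le> l \<Longrightarrow> s_from i l a b c =
     replicate (b i) (Plain 2) @ Plain (c i) # replicate (a i) (Plain 2) @ Plain 1 # s_from (Suc i) l a b c"
  unfolding s_from_def by (simp add: upt_conv_Cons del: upt_Suc)

lemma sum_merged_H_cal:
  assumes "q > 0" "box_linear r (map (snd \<circ> snd) T)"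
  shows "(\<Sum>(p, p', p'') \<in># merged (s # map fst T) (t # map (fst \<circ> snd) T) (r # map (snd \<circ> snd) T). H_cal q n p p' p'')
    = (\<Sum>k=1..n. q_binom q n k / q_binom q (n + k) k * (lead_weight q (s, t, r) k * merge_factor q T k))"
proof -
  have "(\<Sum>(p, p', p'') \<in># merged (s # map fst T) (t # map (fst \<circ> snd) T) (r # map (snd \<circ> snd) T). H_cal q n p p' p'')
    = (\<Sum>cs | length cs = length T. H_cal q n
            (merge_runs snum_plus (s # map fst T) cs) (merge_runs (+) (t # map (fst \<circ> snd) T) cs)
            (merge_runs zth_plus (r # map (snd \<circ> snd) T) cs))"
    by (simp add: merged_def sum_unfold_sum_mset image_mset.compositionality comp_def)
  also have "\<dots> = (\<Sum>k=1..n. q_binom q n k / q_binom q (n + k) k * lead_weight q (s, t, r) k * merge_factor q T k)"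
    unfolding H_cal_eq_H_strict by (rule sum_merge_runs_H_strict[OF assms])
  finally show ?thesis by (simp only: mult.assoc)
qed

section \<open>Assembling the blocks\<close>

context q_unit
begin

text \<open>Downward induction on \<open>i\<close>: \<open>B_expansion_block\<close> prepends block
  \<open>i\<close> to the 1 closing it, and \<open>B_expansion_one_Cons\<close> then prepends the 1
  in front of it. The free factor \<tau>^2 (1 + q^k) suits both a further block and the opening of
  case (B).\<close>

lemma B_expansion_s_from:
  assumes "\<And>j. 1 \<le> j \<Longrightarrow> j \<le> l \<Longrightarrow> c j \<ge> 3" "1 \<le> i" "i \<le> Suc l"
  shows "B_expansion (\<lambda>n. H_star q n (Plain 1 # s_from i l a b c))
    (\<lambda>k. - (q ^ k / qn k * (\<tau> k ^ 2 * (1 + q ^ k) * merge_factor q (p_tail i l a b c) k)))"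
  using assms(3,2)
proof (induction i rule: inc_induct)
  case base
  \<comment> \<open>The final 2s acting on the constant 1 produce the last entry, still with
    \<open>Z 1\<close>; the 1 prepended afterwards makes it \<open>Z (-1)\<close>.\<close>
  have "B_expansion (\<lambda>n. H_star q n []) (\<lambda>k. - ((-1) ^ k * \<tau> k * (1 + q ^ k)))"
    using B_expansion_one by (simp add: H_star_Nil)
  from B_expansion_twos[OF this, of "a (Suc l)"]
  have "B_expansion (\<lambda>n. H_star q n (replicate (a (Suc l)) (Plain 2)))
    (\<lambda>k. - (lead_weight q (Barred (2 * a (Suc l)), a (Suc l), Z 1) k * merge_factor q [] k))"
    by (rule B_expansion_cong)
       (simp_all add: lead_weight_eqs power_divide mult.commute[of "a _"] flip: power_mult)
  from B_expansion_one_Cons[OF this] show ?case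
    by (simp add: s_from_def p_tail_def)
next
  case (step i)
  have il: "i \<le> l" "1 \<le> Suc i" using step.hyps by auto
  have c: "c i - 3 + 3 = c i" using assms(1)[OF step.prems il(1)] by simp
  show ?case unfolding s_from_Cons[OF il(1)] p_tail_Cons[OF il(1)]
    by (rule B_expansion_one_Cons, rule B_expansion_block[where e = "c i - 3", unfolded c], rule step.IH[OF il(2)])
qed

end

theorem theorem6p7:
  fixes q :: real and n l :: nat and a b c :: "nat \<Rightarrow> nat"
  assumes "0 < q" and "q < 1"
    and "n \<ge> 1"
    and "a (l + 1) \<ge> 1"
    and "\<And>j. 1 \<le> j \<Longrightarrow> j \<le> l \<Longrightarrow> c j \<ge> 3"
  shows "(l \<ge> 1 \<longrightarrow>
           H_star q n (s_A l a b c) = - (\<Sum>(p, p', p'') \<in># Pi_A l a b c. H_cal q n p p' p''))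
       \<and> H_star q n (s_B l a b c) = - (\<Sum>(p, p', p'') \<in># Pi_B l a b c. H_cal q n p p' p'')"
proof (intro conjI impI)
  interpret q_unit q by unfold_locales (use assms in auto)
  have s_tail: "s_tail l a b c = s_from 1 l a b c"
    by (simp add: s_tail_def s_from_def)
  show "H_star q n (s_B l a b c) = - (\<Sum>(p, p', p'') \<in># Pi_B l a b c. H_cal q n p p' p'')"
  proof -
    \<comment> \<open>The factor \<tau>^2 (1 + q^k) left by the first 1 is absorbed into an entry
      with \<open>Z 2\<close>, and the \<open>a 0\<close> leading 2s raise its exponent to
      \<open>2 * a 0 + 1\<close>.\<close>
    have "B_expansion (\<lambda>n. H_star q n (s_B l a b c))
      (\<lambda>k. - (lead_weight q (Plain (2 * a 0 + 1), a 0 + 1, Z 2) k * merge_factor q (p_tail 1 l a b c) k))"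
      unfolding s_B_def s_tail append_Cons append_Nil
      by (rule B_expansion_cong[OF B_expansion_twos[OF B_expansion_s_from[where c = c and l = l, OF assms(5)]]])
         (simp_all add: lead_weight_eqs power_divide power_add mult_ac flip: power_mult)
    moreover have "box_linear (Z 2) (map (snd \<circ> snd) (p_tail 1 l a b c))"
      unfolding p_tail_proj by (rule box_linear_p3_tail) auto
    note sum_merged_H_cal[OF q_pos this, where s = "Plain (2 * a 0 + 1)" and t = "a 0 + 1" and n = n, unfolded p_tail_proj]
    ultimately show ?thesis using \<open>n \<ge> 1\<close>
      by (simp add: Pi_B_def B_expansion_def B_def sum_negf)
  qed
  assume "l \<ge> 1"
  let ?T = "replicate (c 1 - 3) (Plain 1, 0, Theta) @ (Barred (2 * a 1 + 2), a 1 + 1, Z 1) # p_tail 2 l a b c"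
  have c: "c 1 - 3 + 3 = c 1" using assms(5)[of 1] \<open>l \<ge> 1\<close> by simp
  \<comment> \<open>No 1 stands before the first block, so its first entry keeps \<open>Z 1\<close>.
    The remainder starts at \<open>i = 2\<close>, which for \<open>l = 1\<close> is the base case
    \<open>Suc l\<close>.\<close>
  have "B_expansion (\<lambda>n. H_star q n (s_A l a b c))
    (\<lambda>k. - (lead_weight q (Barred (2 * b 1 + 2), b 1 + 1, Z 1) k * merge_factor q ?T k))"
    unfolding s_A_def s_tail s_from_Cons[OF \<open>l \<ge> 1\<close>]
    by (rule B_expansion_block[where e = "c 1 - 3", unfolded c])
       (use B_expansion_s_from[where i = 2 and l = l and c = c and a = a and b = b, OF assms(5)] \<open>l \<ge> 1\<close>
         in \<open>simp add: numeral_2_eq_2\<close>)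
  moreover have proj: "p1_tail l a b c = Barred (2 * b 1 + 2) # map fst ?T"
    "p2_tail l a b c = (b 1 + 1) # map (fst \<circ> snd) ?T"
    "map (snd \<circ> snd) ?T = replicate (c 1 - 3) Theta @ Z 1 # p3_tail 2 l c"
    unfolding p_tail_proj(1,2)[symmetric] p_tail_proj(3)[of 2 l a b c, symmetric] p_tail_Cons[OF \<open>l \<ge> 1\<close>]
    by (simp_all add: numeral_2_eq_2)
  have "box_linear (Z 1) (map (snd \<circ> snd) ?T)"
    unfolding proj by (rule box_linear_thetas) (use \<open>l \<ge> 1\<close> in \<open>auto intro!: box_linear_p3_tail\<close>)
  note sum_merged_H_cal[OF q_pos this, where s = "Barred (2 * b 1 + 2)" and t = "b 1 + 1" and n = n,
      folded proj(1,2), unfolded proj(3)]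
  ultimately show "H_star q n (s_A l a b c) = - (\<Sum>(p, p', p'') \<in># Pi_A l a b c. H_cal q n p p' p'')"
    using \<open>n \<ge> 1\<close> by (simp add: Pi_A_def B_expansion_def B_def sum_negf)
qed

end
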